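(* Fix $k\in\mathbb{N}$ and $\beta\in(0,\infty)$, and let $\alpha=\beta\sqrt{n}$. Then, as $n\to\infty$, $$d_{TV}(M_{n,k}^{\alpha},M_{n,k}^{\infty})\to \tfrac12\,\mathbb{E}\bigl|1-\exp(-\mathcal{N})\bigr|,$$ where $\mathcal{N}$ is a Gaussian random variable with $\mathbb{E}[\mathcal{N}]=\frac{k^2}{4\beta^2}$ and $\mathrm{Var}[\mathcal{N}]=\frac{k^2}{2\beta^2}$.
   Context: A $k$-out map on $[n]$ is a map $M:[n]\to[n]^k$, viewed as a digraph on $[n]$ in which each vertex has $k$ out-arcs labeled $1,\dots,k$; $\mathcal{M}_{n,k}$ denotes the set of all such maps. The in-degree $d_j$ of vertex $j$ is the total number of coordinates, over all vertices $i$ and all $k$ labels, of $M(i)$ equal to $j$ (so $d_1+\dots+d_n=kn$). For $\alpha\in(0,\infty)$, the random $k$-out map $M_{n,k}^{\alpha}$ is generated by inserting $kn$ out-arcs, $k$ per vertex: every vertex starts with weight $\alpha$; at each step a vertex whose out-degree is below $k$ picks its next image $j$ with probability proportional to the current weight of $j$, and the weight of $j$ then increases by $1$. Its law is $P(M_{n,k}^{\alpha}=M)=\prod_{j=1}^n \alpha^{\overline{d_j}}/(\alpha n)^{\overline{kn}}$, where $(d_1,\dots,d_n)$ is the in-degree sequence of $M$ and $x^{\overline{y}}=x(x+1)\cdots(x+y-1)$. $M_{n,k}^{\infty}$ denotes the uniformly random element of $\mathcal{M}_{n,k}$ (probability $n^{-kn}$ each). $d_{TV}(M_{n,k}^{\alpha},M_{n,k}^{\infty})=\sup_{\mathcal{A}\subseteq\mathcal{M}_{n,k}}|P(M_{n,k}^{\alpha}\in\mathcal{A})-P(M_{n,k}^{\infty}\in\mathcal{A})|$.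 *)

theory Defs
  imports "HOL-Probability.Probability"
begin

text \<open>k-out maps on [n] = {1..n}: a map M assigns to each vertex i and label l in {1..k}
  the image M (i,l) in {1..n}. Represented as extensional functions.\<close>
definition kout_maps :: "nat \<Rightarrow> nat \<Rightarrow> (nat \<times> nat \<Rightarrow> nat) set" where
  "kout_maps n k = ({1..n} \<times> {1..k}) \<rightarrow>\<^sub>E {1..n}"

definition indeg :: "nat \<Rightarrow> nat \<Rightarrow> (nat \<times> nat \<Rightarrow> nat) \<Rightarrow> nat \<Rightarrow> nat" where
  "indeg n k M j = card {p \<in> {1..n} \<times> {1..k}. M p = j}"

definition prob_alpha :: "nat \<Rightarrow> nat \<Rightarrow> real \<Rightarrow> (nat \<times> nat \<Rightarrow> nat) \<Rightarrow> real" where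
  "prob_alpha n k \<alpha> M =
     (\<Prod>j\<in>{1..n}. pochhammer \<alpha> (indeg n k M j)) / pochhammer (\<alpha> * real n) (k * n)"

definition prob_unif :: "nat \<Rightarrow> nat \<Rightarrow> (nat \<times> nat \<Rightarrow> nat) \<Rightarrow> real" where
  "prob_unif n k M = 1 / real n ^ (k * n)"

definition dTV_alpha_unif :: "nat \<Rightarrow> nat \<Rightarrow> real \<Rightarrow> real" where
  "dTV_alpha_unif n k \<alpha> =
     (SUP A \<in> Pow (kout_maps n k).
        \<bar>(\<Sum>M\<in>A. prob_alpha n k \<alpha> M) - (\<Sum>M\<in>A. prob_unif n k M)\<bar>)"

end

theory Submission
  imports Defs
begin

text \<open>Let $L$ be the likelihood ratio of $M^\alpha$ against the uniform map; it depends on the in-degrees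
  only. Since $L$ has mean 1 under the uniform law, the total variation distance is $E(1-L)^+$, the mean
  of a bounded continuous function of $\ln L$, so it suffices that $-\ln L$ tends to $\mathcal N$ in
  distribution. Throw the $kn$ arcs one at a time: a throw into a vertex of current in-degree $d$ at time
  $m$ multiplies $L$ by $(1+d/\alpha)/(1+m/(\alpha n))$. Given the past, the characteristic function of the
  logarithm of this factor is, up to $O(n^{-3/2})$ in mean, $\exp(-(it+t^2)s/(2\alpha^2))$ with the deterministic
  $s = m/n - m/n^2$, because the empirical variance of the in-degrees concentrates around $s$.
  All factors have modulus at most 1, so the errors of the $kn$ steps add up to $O(n^{-1/2})$;
  Levy's continuity theorem concludes.\<close>

section \<open>Averages over the occupation vectors of uniform throws\<close>

text \<open>The mean of \<open>G\<close> over the occupation vector of \<open>n\<close> boxes after \<open>m\<close> independent uniform throws,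
  see \<open>mexp_eq_average\<close>; the recursion conditions on all throws but the last.\<close>
primrec mexp :: "nat \<Rightarrow> nat \<Rightarrow> ((nat \<Rightarrow> nat) \<Rightarrow> 'a::real_vector) \<Rightarrow> 'a" where
  "mexp n 0 G = G (\<lambda>_. 0)"
| "mexp n (Suc m) G = mexp n m (\<lambda>d. (1 / real n) *\<^sub>R (\<Sum>v\<in>{1..n}. G (d(v := Suc (d v)))))"

lemma sum_fun_upd_Suc:
  fixes h :: "nat \<Rightarrow> 'a::ab_group_add" and v n :: nat
  assumes "v \<in> {1..n}"
  shows "(\<Sum>u\<in>{1..n}. h ((d(v := Suc (d v))) u)) = (\<Sum>u\<in>{1..n}. h (d u)) + (h (Suc (d v)) - h (d v))"
proof -
  have "(\<Sum>u\<in>{1..n}. h ((d(v := Suc (d v))) u)) =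
      (\<Sum>u\<in>{1..n}. h (d u) + (if u = v then h (Suc (d v)) - h (d v) else 0))"
    by (rule sum.cong) auto
  also have "\<dots> = (\<Sum>u\<in>{1..n}. h (d u)) + (\<Sum>u\<in>{1..n}. if u = v then h (Suc (d v)) - h (d v) else 0)"
    by (rule sum.distrib)
  also have "(\<Sum>u\<in>{1..n}. if u = v then h (Suc (d v)) - h (d v) else 0) = h (Suc (d v)) - h (d v)"
    by (subst sum.delta) (use assms in auto)
  finally show ?thesis .
qed

text \<open>The general update rule involves a difference, hence the detour through
  \<open>int\<close>.\<close>

lemma sum_fun_upd_Suc_nat:
  fixes d :: "nat \<Rightarrow> nat" and v n :: nat
  assumes "v \<in> {1..n}"
  shows "sum (d(v := Suc (d v))) {1..n} = Suc (sum d {1..n})"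
proof -
  have "int (sum (d(v := Suc (d v))) {1..n}) = int (Suc (sum d {1..n}))"
    using sum_fun_upd_Suc[OF assms, of int d] by simp
  then show ?thesis by (simp only: of_nat_eq_iff)
qed

text \<open>Each throw raises the total by one, so \<open>mexp n m\<close> only sees vectors with
  total \<open>m\<close>. This is what later fixes the mean occupation number at m/n.\<close>

lemma mexp_cong:
  assumes "\<And>d. sum d {1..n} = m \<Longrightarrow> G d = H d"
  shows "mexp n m G = mexp n m H"
  using assms
proof (induction m arbitrary: G H)
  case 0
  then show ?case by simp
next
  case (Suc m)
  show ?case
    unfolding mexp.simps
    by (intro Suc.IH arg_cong2[of _ _ _ _ scaleR] sum.cong Suc.prems refl) (simp only: sum_fun_upd_Suc_nat)
qed

lemma mexp_add: "mexp n m (\<lambda>d. G d + H d) = mexp n m G + mexp n m H"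
  by (induction m arbitrary: G H) (simp_all add: sum.distrib scaleR_add_right)

lemma mexp_scaleR: "mexp n m (\<lambda>d. c *\<^sub>R G d) = c *\<^sub>R mexp n m G"
proof (induction m arbitrary: G)
  case (Suc m)
  show ?case
    unfolding mexp.simps scaleR_sum_right[symmetric] scaleR_left_commute[of _ c] by (rule Suc.IH)
qed simp

lemma mexp_mult:
  fixes c :: "'a::real_algebra"
  shows "mexp n m (\<lambda>d. c * G d) = c * mexp n m G"
proof (induction m arbitrary: G)
  case (Suc m)
  show ?case
    unfolding mexp.simps sum_distrib_left[symmetric] mult_scaleR_right[symmetric] by (rule Suc.IH)
qed simp

lemma mexp_const: "n > 0 \<Longrightarrow> mexp n m (\<lambda>_. c) = c"
proof (induction m)
  case (Suc m)
  then show ?case by (simp add: sum_constant_scaleR)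
qed simp

lemma mexp_mono:
  fixes G H :: "_ \<Rightarrow> real"
  assumes "\<And>d. sum d {1..n} = m \<Longrightarrow> G d \<le> H d"
  shows "mexp n m G \<le> mexp n m H"
  using assms
proof (induction m arbitrary: G H)
  case (Suc m)
  show ?case
    unfolding mexp.simps
    by (intro Suc.IH scaleR_left_mono sum_mono Suc.prems divide_nonneg_nonneg zero_le_one of_nat_0_le_iff)
      (simp only: sum_fun_upd_Suc_nat)
qed simp

lemma norm_mexp_le:
  fixes G :: "_ \<Rightarrow> 'a::real_normed_vector"
  shows "norm (mexp n m G) \<le> mexp n m (\<lambda>d. norm (G d))"
proof (induction m arbitrary: G)
  case (Suc m)
  have "norm (mexp n (Suc m) G) \<le> mexp n m (\<lambda>d. norm ((1 / real n) *\<^sub>R (\<Sum>v\<in>{1..n}. G (d(v := Suc (d v))))))"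
    unfolding mexp.simps by (rule Suc.IH)
  also have "\<dots> \<le> mexp n (Suc m) (\<lambda>d. norm (G d))"
    unfolding mexp.simps by (rule mexp_mono) (simp add: divide_right_mono norm_sum)
  finally show ?case .
qed simp

text \<open>Induction on the index set: the image of the newly inserted arc plays the part of the
  last throw. This carries averages over all maps to the recursion.\<close>

lemma mexp_eq_average:
  assumes "finite I" "n > 0"
  shows "(\<Sum>f\<in>I \<rightarrow>\<^sub>E {1..n}. G (\<lambda>j. card {p\<in>I. f p = j})) = (real n ^ card I) *\<^sub>R mexp n (card I) G"
  using assms(1)
proof (induction I arbitrary: G rule: finite_induct)
  case empty
  then show ?case by simp
next
  case (insert x I)
  have inj: "inj_on (\<lambda>(y, g). g(x := y)) ({1..n} \<times> (I \<rightarrow>\<^sub>E {1..n}))"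
    using insert by (intro inj_combinator) auto
  have deg: "(\<lambda>j. card {p\<in>insert x I. (f(x := y)) p = j}) =
      (\<lambda>j. card {p\<in>I. f p = j})(y := Suc (card {p\<in>I. f p = y}))" for f :: "_ \<Rightarrow> nat" and y
  proof
    fix j
    have "{p\<in>insert x I. (f(x := y)) p = j} = (if j = y then insert x {p\<in>I. f p = j} else {p\<in>I. f p = j})"
      using insert by auto
    then show "card {p\<in>insert x I. (f(x := y)) p = j} =
      ((\<lambda>j. card {p\<in>I. f p = j})(y := Suc (card {p\<in>I. f p = y}))) j"
      using insert by auto
  qed
  have "(\<Sum>f\<in>insert x I \<rightarrow>\<^sub>E {1..n}. G (\<lambda>j. card {p\<in>insert x I. f p = j})) =
     (\<Sum>(y, f)\<in>{1..n} \<times> (I \<rightarrow>\<^sub>E {1..n}). G (\<lambda>j. card {p\<in>insert x I. (f(x := y)) p = j}))"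
    unfolding PiE_insert_eq by (subst sum.reindex[OF inj]) (simp add: case_prod_unfold)
  also have "\<dots> = (\<Sum>f\<in>I \<rightarrow>\<^sub>E {1..n}. \<Sum>y\<in>{1..n}. G ((\<lambda>j. card {p\<in>I. f p = j})(y := Suc (card {p\<in>I. f p = y}))))"
    unfolding deg by (subst sum.swap) (simp add: sum.cartesian_product)
  also have "\<dots> = (real n ^ card I) *\<^sub>R mexp n (card I) (\<lambda>d. \<Sum>y\<in>{1..n}. G (d(y := Suc (d y))))"
    by (rule insert.IH)
  finally show ?case
    using insert assms(2) by (simp add: mexp_scaleR)
qed

subsection \<open>Moments of the occupation numbers\<close>

definition avg_pow :: "nat \<Rightarrow> nat \<Rightarrow> (nat \<Rightarrow> nat) \<Rightarrow> real" where
  "avg_pow n r d = (\<Sum>v\<in>{1..n}. real (d v) ^ r) / real n"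

lemma avg_pow_upd: "v \<in> {1..n} \<Longrightarrow>
   avg_pow n r (d(v := Suc (d v))) = avg_pow n r d + (real (Suc (d v)) ^ r - real (d v) ^ r) / real n"
  unfolding avg_pow_def sum_fun_upd_Suc[of v n "\<lambda>i. real i ^ r" d] by (simp add: field_simps)

lemma avg_pow_1: "sum d {1..n} = m \<Longrightarrow> avg_pow n 1 d = real m / real n"
  by (auto simp: avg_pow_def)

text \<open>A throw into \<open>v\<close> raises the sum of squares by 2 d(v) + 1. Averaged over
  \<open>v\<close> this is 2m/n + 1 whatever the past, so the mean has a closed form.\<close>

lemma mexp_avg_pow_2:
  assumes "n > 0"
  shows "mexp n m (avg_pow n 2) = real m / real n + real m * (real m - 1) / (real n)\<^sup>2"
proof (induction m)
  case 0
  then show ?case by (simp add: avg_pow_def)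
next
  case (Suc m)
  have "mexp n (Suc m) (avg_pow n 2) = mexp n m (\<lambda>d. avg_pow n 2 d + (1 / real n + 2 * real m / (real n)\<^sup>2))"
    unfolding mexp.simps
  proof (rule mexp_cong)
    fix d :: "nat \<Rightarrow> nat" assume d: "sum d {1..n} = m"
    have "(\<Sum>v\<in>{1..n}. avg_pow n 2 (d(v := Suc (d v)))) = (\<Sum>v\<in>{1..n}. avg_pow n 2 d + (2 * real (d v) + 1) / real n)"
      by (intro sum.cong refl, subst avg_pow_upd) (auto simp: power2_eq_square field_simps)
    also have "\<dots> = n * avg_pow n 2 d + (2 * real m + n) / n"
      using d by (simp add: sum.distrib sum_divide_distrib[symmetric] sum_distrib_left[symmetric] flip: of_nat_sum)
    finally show "(1 / real n) *\<^sub>R (\<Sum>v\<in>{1..n}. avg_pow n 2 (d(v := Suc (d v)))) =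
       avg_pow n 2 d + (1 / real n + 2 * real m / (real n)\<^sup>2)"
      using assms by (simp add: field_simps power2_eq_square)
  qed
  also have "\<dots> = mexp n m (avg_pow n 2) + (1 / real n + 2 * real m / (real n)\<^sup>2)"
    using assms by (simp add: mexp_add mexp_const)
  also have "\<dots> = real (Suc m) / real n + real (Suc m) * (real (Suc m) - 1) / (real n)\<^sup>2"
    using assms unfolding Suc by (simp add: field_simps power2_eq_square)
  finally show ?case .
qed

lemma mexp_avg_pow_2_le:
  assumes "n > 0" "m \<le> k * n"
  shows "mexp n m (avg_pow n 2) \<le> real k + (real k)\<^sup>2"
proof -
  have mk: "real m \<le> real k * real n" using assms(2) by (metis of_nat_le_iff of_nat_mult)
  have a: "real m / real n \<le> k" using assms mk by (simp add: field_simps)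
  have "real m * (real m - 1) / (real n)\<^sup>2 \<le> (real m / real n)\<^sup>2"
    by (simp add: power_divide divide_right_mono power2_eq_square algebra_simps)
  also have "\<dots> \<le> (real k)\<^sup>2" using a by (intro power_mono) auto
  finally show ?thesis using a unfolding mexp_avg_pow_2[OF assms(1)] by linarith
qed

text \<open>Each throw increases the mean by at most (3(k + k^2) + 3k + 1)/n, from the bound on the
  second moment and from m/n \<le> k; this is the source of the constant.\<close>

lemma mexp_avg_pow_3_le:
  assumes "n > 0" "m \<le> k * n"
  shows "mexp n m (avg_pow n 3) \<le> real m / real n * (3 * (real k)\<^sup>2 + 6 * real k + 1)"
  using assms(2)
proof (induction m)
  case 0
  then show ?case by (simp add: avg_pow_def)
next
  case (Suc m)
  have mk: "real m \<le> real k * real n" using Suc.prems by (metis Suc_leD of_nat_le_iff of_nat_mult)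
  have "mexp n (Suc m) (avg_pow n 3) = mexp n m (\<lambda>d. avg_pow n 3 d + (3 / real n) * avg_pow n 2 d + (3 * (real m / n) + 1) / n)"
    unfolding mexp.simps
  proof (rule mexp_cong)
    fix d :: "nat \<Rightarrow> nat" assume d: "sum d {1..n} = m"
    have "(\<Sum>v\<in>{1..n}. avg_pow n 3 (d(v := Suc (d v)))) =
       (\<Sum>v\<in>{1..n}. avg_pow n 3 d + (3 * real (d v)^2 + 3 * real (d v) ^ 1 + 1) / real n)"
      by (intro sum.cong refl, subst avg_pow_upd) (auto simp: power2_eq_square power3_eq_cube field_simps)
    also have "\<dots> = n * avg_pow n 3 d + (3 * (n * avg_pow n 2 d) + 3 * (n * avg_pow n 1 d) + n) / n"
      using assms by (simp add: avg_pow_def sum.distrib sum_divide_distrib[symmetric] sum_distrib_left[symmetric])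
    finally show "(1 / real n) *\<^sub>R (\<Sum>v\<in>{1..n}. avg_pow n 3 (d(v := Suc (d v)))) =
       avg_pow n 3 d + (3 / real n) * avg_pow n 2 d + (3 * (real m / n) + 1) / n"
      using assms unfolding avg_pow_1[OF d] by (simp add: field_simps)
  qed
  also have "\<dots> = mexp n m (avg_pow n 3) + 3 / real n * mexp n m (avg_pow n 2) + (3 * (real m / n) + 1) / n"
    using assms by (simp only: mexp_add mexp_const mexp_mult)
  also have "\<dots> \<le> real m / real n * (3 * (real k)\<^sup>2 + 6 * real k + 1) + 3 / real n * (real k + (real k)\<^sup>2) + (3 * real k + 1) / n"
    using assms Suc mk by (intro add_mono mult_left_mono Suc.IH mexp_avg_pow_2_le divide_right_mono) (auto simp: field_simps)
  also have "\<dots> = real (Suc m) / real n * (3 * (real k)\<^sup>2 + 6 * real k + 1)"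
    using assms by (simp add: field_simps)
  finally show ?case .
qed

text \<open>The subtracted term is the exact mean found in \<open>mexp_avg_pow_2\<close>. For
  vectors of total \<open>m\<close> the value is the centred number of ordered pairs of distinct
  throws into the same box, divided by \<open>n\<close>.\<close>

definition collision_dev :: "nat \<Rightarrow> nat \<Rightarrow> (nat \<Rightarrow> nat) \<Rightarrow> real" where
  "collision_dev n m d = avg_pow n 2 d - (real m / real n + real m * (real m - 1) / (real n)\<^sup>2)"

text \<open>The deviation is a martingale: a throw into \<open>v\<close> adds 2(d(v) - m/n)/n, which
  has mean zero given the past. Hence the second moments of the increments add up, each at most
  4/n^2 times the mean of \<open>avg_pow n 2\<close>.\<close>

lemma mexp_collision_dev_sq_le:
  assumes "n > 0" "m \<le> k * n"
  shows "mexp n m (\<lambda>d. (collision_dev n m d)\<^sup>2) \<le> real m * (4 * (real k + (real k)\<^sup>2) / (real n)\<^sup>2)"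
  using assms(2)
proof (induction m)
  case 0
  then show ?case by (simp add: avg_pow_def collision_dev_def)
next
  case (Suc m)
  have "mexp n (Suc m) (\<lambda>d. (collision_dev n (Suc m) d)\<^sup>2) \<le>
      mexp n m (\<lambda>d. (collision_dev n m d)\<^sup>2 + 4 / (real n)\<^sup>2 * avg_pow n 2 d)"
    unfolding mexp.simps
  proof (rule mexp_mono)
    fix d :: "nat \<Rightarrow> nat" assume d: "sum d {1..n} = m"
    define e where "e = collision_dev n m d"
    define y where "y = real m / real n"
    have sd: "(\<Sum>v\<in>{1..n}. real (d v)) = n * y"
      using d assms by (simp add: y_def flip: of_nat_sum)
    have sd2: "(\<Sum>v\<in>{1..n}. (real (d v))\<^sup>2) = n * avg_pow n 2 d"
      using assms by (simp add: avg_pow_def)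
    have "(\<Sum>v\<in>{1..n}. (collision_dev n (Suc m) (d(v := Suc (d v))))\<^sup>2) =
       (\<Sum>v\<in>{1..n}. (e + 2 * (real (d v) - y) / n)\<^sup>2)"
    proof (intro sum.cong refl arg_cong[of _ _ "\<lambda>x. x\<^sup>2"])
      fix v assume v: "v \<in> {1..n}"
      show "collision_dev n (Suc m) (d(v := Suc (d v))) = e + 2 * (real (d v) - y) / n"
        using assms unfolding collision_dev_def avg_pow_upd[OF v] e_def y_def
        by (simp add: field_simps power2_eq_square)
    qed
    also have "\<dots> = (\<Sum>v\<in>{1..n}. (e\<^sup>2 - 4 * e * y / n + 4 * y\<^sup>2 / n\<^sup>2) + (4 * e / n - 8 * y / n\<^sup>2) * real (d v) + 4 / n\<^sup>2 * (real (d v))\<^sup>2)"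
      using assms by (intro sum.cong refl) (simp add: field_simps power2_eq_square)
    also have "\<dots> = n * (e\<^sup>2 - 4 * e * y / n + 4 * y\<^sup>2 / n\<^sup>2) + (4 * e / n - 8 * y / n\<^sup>2) * (n * y) + 4 / n\<^sup>2 * (n * avg_pow n 2 d)"
      unfolding sum.distrib sum_distrib_left[symmetric] sd sd2 by (simp add: algebra_simps)
    \<comment> \<open>The terms linear in \<open>e\<close> cancel because the occupation numbers
      average to \<open>y\<close>.\<close>
    also have "\<dots> = n * (e\<^sup>2 + 4 / n\<^sup>2 * (avg_pow n 2 d - y\<^sup>2))"
      using assms by (simp add: algebra_simps, simp add: field_simps power2_eq_square)
    also have "\<dots> \<le> n * (e\<^sup>2 + 4 / n\<^sup>2 * avg_pow n 2 d)"
      by (intro mult_left_mono add_left_mono) auto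
    finally show "(1 / real n) *\<^sub>R (\<Sum>v\<in>{1..n}. (collision_dev n (Suc m) (d(v := Suc (d v))))\<^sup>2) \<le>
       (collision_dev n m d)\<^sup>2 + 4 / (real n)\<^sup>2 * avg_pow n 2 d"
      using assms unfolding e_def by (simp add: field_simps)
  qed
  also have "\<dots> = mexp n m (\<lambda>d. (collision_dev n m d)\<^sup>2) + 4 / (real n)\<^sup>2 * mexp n m (avg_pow n 2)"
    by (simp only: mexp_add mexp_mult)
  also have "\<dots> \<le> real m * (4 * (real k + (real k)\<^sup>2) / (real n)\<^sup>2) + 4 / (real n)\<^sup>2 * (real k + (real k)\<^sup>2)"
    using assms Suc by (intro add_mono mult_left_mono Suc.IH mexp_avg_pow_2_le) auto
  also have "\<dots> = real (Suc m) * (4 * (real k + (real k)\<^sup>2) / (real n)\<^sup>2)"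
    by (simp add: algebra_simps add_divide_distrib)
  finally show ?case .
qed

text \<open>The second moment is O(1/n), so the first absolute moment is O(1/sqrt n). The pointwise
  bound x \<le> sqrt n * x^2 + 1/sqrt n stands in for Cauchy-Schwarz; the weight sqrt n balances the
  two terms.\<close>

lemma mexp_abs_collision_dev_le:
  assumes "n > 0" "m \<le> k * n"
  shows "mexp n m (\<lambda>d. \<bar>collision_dev n m d\<bar>) \<le> (4 * real k * (real k + (real k)\<^sup>2) + 1) / sqrt n"
proof -
  have mk: "real m \<le> real k * real n" using assms(2) by (metis of_nat_le_iff of_nat_mult)
  have s: "sqrt n > 0" "sqrt n * sqrt n = n" using assms by auto
  have "mexp n m (\<lambda>d. \<bar>collision_dev n m d\<bar>) \<le> mexp n m (\<lambda>d. sqrt n * (collision_dev n m d)\<^sup>2 + 1 / sqrt n)"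
  proof (rule mexp_mono)
    fix d
    define x where "x = \<bar>collision_dev n m d\<bar>"
    have "x \<ge> 0" by (simp add: x_def)
    \<comment> \<open>With z = sqrt n * x this is z^2 - z + 1 \<ge> 0, the claim multiplied by sqrt
      n.\<close>
    have "0 \<le> (sqrt n * x - 1)\<^sup>2 + sqrt n * x" using s \<open>x \<ge> 0\<close> by (intro add_nonneg_nonneg) auto
    then have "sqrt n * x \<le> sqrt n * (sqrt n * x\<^sup>2 + 1 / sqrt n)"
      using s by (simp add: power2_eq_square algebra_simps)
    then have "x \<le> sqrt n * x\<^sup>2 + 1 / sqrt n" using s by (simp only: mult_le_cancel_left_pos)
    then show "\<bar>collision_dev n m d\<bar> \<le> sqrt n * (collision_dev n m d)\<^sup>2 + 1 / sqrt n"
      by (simp add: x_def)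
  qed
  also have "\<dots> = sqrt n * mexp n m (\<lambda>d. (collision_dev n m d)\<^sup>2) + 1 / sqrt n"
    using assms by (simp add: mexp_add mexp_mult mexp_const)
  also have "\<dots> \<le> sqrt n * ((real k * real n) * (4 * (real k + (real k)\<^sup>2) / (real n)\<^sup>2)) + 1 / sqrt n"
    using assms mk order_trans[OF mexp_collision_dev_sq_le[OF assms] mult_right_mono[OF mk]]
    by (intro add_right_mono mult_left_mono) auto
  also have "\<dots> = (4 * real k * (real k + (real k)\<^sup>2) + 1) / sqrt n"
  proof -
    have "sqrt n * ((real k * real n) * (4 * (real k + (real k)\<^sup>2) / (real n)\<^sup>2)) =
      (sqrt n / n) * (4 * real k * (real k + (real k)\<^sup>2))"
      using assms by (simp add: field_simps power2_eq_square)
    moreover have "sqrt n / n = 1 / sqrt n" using s assms by (simp add: field_simps)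
    ultimately show ?thesis by (simp add: add_divide_distrib)
  qed
  finally show ?thesis .
qed

subsection \<open>Characteristic function of the log-likelihood ratio\<close>

text \<open>The power (1 + x)^(it). At x = d/a it is the factor that a throw into a box of
  occupation d contributes to exp(it \<open>loglam\<close>).\<close>

definition lnchar :: "real \<Rightarrow> real \<Rightarrow> complex" where
  "lnchar t x = iexp (t * ln (1 + x))"

text \<open>Second order coefficient of \<open>lnchar t\<close> at 0.\<close>
definition lnchar2 :: "real \<Rightarrow> complex" where
  "lnchar2 t = - (\<i> * complex_of_real t + (complex_of_real t)\<^sup>2) / 2"

lemma norm_lnchar [simp]: "norm (lnchar t x) = 1"
  by (simp add: lnchar_def)

text \<open>Complex Taylor expansion of (1 + z)^s with s = it along the nonnegative real axis. Its
  second coefficient is s(s - 1)/2, which is \<open>lnchar2 t\<close>. One constant serves both the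
  third order and the first order remainder.\<close>

lemma lnchar_Taylor:
  fixes t :: real
  obtains K where "K \<ge> 0"
    "\<And>x. x \<ge> 0 \<Longrightarrow> norm (lnchar t x - (1 + \<i> * t * x + lnchar2 t * x\<^sup>2)) \<le> K * x ^ 3"
    "\<And>x. x \<ge> 0 \<Longrightarrow> norm (lnchar t x - 1) \<le> K * x"
proof -
  define s where "s = \<i> * complex_of_real t"
  \<comment> \<open>\<open>f i\<close> is the i-th derivative of (1 + z)^s.\<close>
  define f :: "nat \<Rightarrow> complex \<Rightarrow> complex" where
    "f = (\<lambda>i z. (\<Prod>j<i. s - of_nat j) * (1 + z) powr (s - of_nat i))"
  \<comment> \<open>A convex subset of the complex plane on which 1 + z stays off the branch
    cut.\<close>
  define S :: "complex set" where "S = of_real ` {0..}"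
  have S: "convex S" unfolding S_def
    by (intro convex_linear_image) (auto intro: bounded_linear.linear bounded_linear_of_real)
  have der: "(f i has_field_derivative f (Suc i) z) (at z within S)" if "z \<in> S" for i z
  proof -
    have nz: "1 + z \<notin> \<real>\<^sub>\<le>\<^sub>0" using that by (auto simp: S_def complex_nonpos_Reals_iff)
    have "((\<lambda>z. (1 + z) powr (s - of_nat i)) has_field_derivative
        (s - of_nat i) * (1 + z) powr (s - of_nat i - 1)) (at z within S)"
      using nz by (auto intro!: derivative_eq_intros)
    from DERIV_cmult[OF this, of "\<Prod>j<i. s - of_nat j"] show ?thesis
      unfolding f_def by (simp add: mult.assoc diff_diff_eq add.commute)
  qed
  have nf: "norm (f i (of_real x)) \<le> norm (\<Prod>j<i. s - of_nat j)" if "x \<ge> 0" for i x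
  proof -
    \<comment> \<open>As \<open>s\<close> is purely imaginary, only the real exponent -i affects the
      modulus.\<close>
    have "norm ((1 + complex_of_real x) powr (s - of_nat i)) = (1 + x) powr (Re (s - of_nat i))"
      using that norm_powr_real_powr[of "1 + complex_of_real x" "s - of_nat i"] by simp
    also have "\<dots> \<le> 1" using that powr_mono[of "- real i" 0 "1 + x"] by (simp add: s_def)
    finally show ?thesis by (simp add: f_def norm_mult mult_left_le)
  qed
  have f0: "f 0 (of_real x) = lnchar t x" if "x \<ge> 0" for x
  proof -
    have "Ln (1 + complex_of_real x) = complex_of_real (ln (1 + x))"
      using that Ln_of_real[of "1 + x"] by simp
    moreover have "1 + complex_of_real x \<noteq> 0"
      using that by (metis add_nonneg_eq_0_iff of_real_1 of_real_add of_real_eq_0_iff zero_le_one zero_neq_one)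
    ultimately show ?thesis by (simp add: f_def lnchar_def s_def powr_def algebra_simps)
  qed
  define K where "K = norm (\<Prod>j<3. s - of_nat j) + norm (\<Prod>j<1. s - of_nat j)"
  have "norm (lnchar t x - (1 + \<i> * t * x + lnchar2 t * x\<^sup>2)) \<le> K * x ^ 3" if x: "x \<ge> 0" for x
  proof -
    have "norm (f 0 (of_real x) - (\<Sum>i\<le>2. f i 0 * (of_real x - 0) ^ i / fact i)) \<le>
       norm (\<Prod>j<3. s - of_nat j) * norm (of_real x - 0 :: complex) ^ Suc 2 / fact 2"
      by (rule field_Taylor[OF S]) (use x nf[of _ "Suc 2"] der in \<open>auto simp: S_def eval_nat_numeral\<close>)
    also have "(\<Sum>i\<le>2. f i 0 * (of_real x - 0) ^ i / fact i) = 1 + \<i> * t * x + lnchar2 t * x\<^sup>2"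
      by (simp add: f_def eval_nat_numeral s_def lnchar2_def field_simps)
    also have "norm (\<Prod>j<3. s - of_nat j) * norm (of_real x - 0 :: complex) ^ Suc 2 / fact 2 \<le> K * x ^ 3"
      using x by (simp add: K_def eval_nat_numeral field_simps)
    finally show ?thesis using x by (simp add: f0)
  qed
  moreover have "norm (lnchar t x - 1) \<le> K * x" if x: "x \<ge> 0" for x
  proof -
    have "norm (f 0 (of_real x) - (\<Sum>i\<le>0. f i 0 * (of_real x - 0) ^ i / fact i)) \<le>
       norm (\<Prod>j<1. s - of_nat j) * norm (of_real x - 0 :: complex) ^ Suc 0 / fact 0"
      by (rule field_Taylor[OF S]) (use x nf[of _ "1"] der in \<open>auto simp: S_def\<close>)
    also have "\<dots> \<le> K * x"
      using x by (simp add: K_def mult_right_mono)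
    finally show ?thesis using x by (simp add: f0) (simp add: f_def)
  qed
  ultimately show ?thesis by (intro that[of K]) (auto simp: K_def)
qed

section \<open>Product approximation of the characteristic function, throw by throw\<close>

definition loglam :: "nat \<Rightarrow> real \<Rightarrow> (nat \<Rightarrow> nat) \<Rightarrow> real" where
  "loglam n a d = (\<Sum>v\<in>{1..n}. \<Sum>i<d v. ln (1 + real i / a))"

text \<open>For a > 0, \<open>loglam n a d\<close> is the logarithm of the product over
  \<open>v\<close> of \<open>pochhammer a (d v) / a ^ d v\<close>, the likelihood ratio before
  normalization; a throw into \<open>v\<close> appends one factor to it.\<close>

lemma loglam_upd:
  assumes "v \<in> {1..n}"
  shows "loglam n a (d(v := Suc (d v))) = loglam n a d + ln (1 + real (d v) / a)"
  unfolding loglam_def sum_fun_upd_Suc[OF assms, of "\<lambda>j. \<Sum>i<j. ln (1 + real i / a)"] by simp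

text \<open>Deterministic approximation to the conditional mean of \<open>lnchar t (d v / a)\<close> at throw \<open>m\<close>: the mean of the
  argument is exactly \<open>m / (n * a)\<close>, and its variance is close to that of one multinomial occupation number.\<close>
definition stepfac :: "nat \<Rightarrow> real \<Rightarrow> real \<Rightarrow> nat \<Rightarrow> complex" where
  "stepfac n a t m = lnchar t (real m / (real n * a)) *
     exp (lnchar2 t * complex_of_real ((real m / real n - real m / (real n)\<^sup>2) / a\<^sup>2))"

text \<open>Conditioning on all throws but the last replaces the last factor by its conditional
  mean, which \<open>stepfac\<close> approximates with mean error at most \<open>E\<close>. Both the
  accumulated exponential and \<open>stepfac\<close> have modulus at most 1, so the errors add and
  are never amplified.\<close>

lemma mexp_char_approx:
  assumes n: "n > 0"
    and avg: "\<And>m. m < N \<Longrightarrow> mexp n m (\<lambda>d. norm ((1 / real n) *\<^sub>R (\<Sum>v\<in>{1..n}. lnchar t (real (d v) / a)) - stepfac n a t m)) \<le> E"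
  shows "m \<le> N \<Longrightarrow> norm (mexp n m (\<lambda>d. iexp (t * loglam n a d)) - (\<Prod>l<m. stepfac n a t l)) \<le> real m * E"
proof (induction m)
  case 0
  then show ?case by (simp add: loglam_def)
next
  case (Suc m)
  let ?A = "\<lambda>d. (1 / real n) *\<^sub>R (\<Sum>v\<in>{1..n}. lnchar t (real (d v) / a))"
  have st: "norm (stepfac n a t m) \<le> 1"
  proof -
    \<comment> \<open>The approximate variance must be nonnegative: since \<open>lnchar2 t\<close>
      has real part -t^2/2, the exponential in \<open>stepfac\<close> then has modulus at most
      1.\<close>
    have "real m / (real n)\<^sup>2 \<le> real m / real n"
      using n by (intro divide_left_mono) (auto simp: power2_eq_square)
    then have w: "(real m / real n - real m / (real n)\<^sup>2) / a\<^sup>2 \<ge> 0" (is "?w \<ge> 0")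
      by (intro divide_nonneg_nonneg) auto
    have "norm (stepfac n a t m) = exp (Re (lnchar2 t * complex_of_real ?w))"
      unfolding stepfac_def norm_mult norm_lnchar norm_exp_eq_Re by (rule mult_1_left)
    also have "Re (lnchar2 t * complex_of_real w) = - (t\<^sup>2 * w / 2)" for w
      by (simp add: lnchar2_def power2_eq_square)
    also have "exp (- (t\<^sup>2 * ?w / 2)) \<le> exp 0"
      unfolding exp_le_cancel_iff neg_le_0_iff_le
      by (rule divide_nonneg_nonneg[OF mult_nonneg_nonneg[OF zero_le_power2 w]]) simp
    finally show ?thesis by simp
  qed
  have "mexp n (Suc m) (\<lambda>d. iexp (t * loglam n a d)) = mexp n m (\<lambda>d. iexp (t * loglam n a d) * ?A d)"
    unfolding mexp.simps
  proof (rule mexp_cong)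
    fix d :: "nat \<Rightarrow> nat"
    have "(\<Sum>v\<in>{1..n}. iexp (t * loglam n a (d(v := Suc (d v))))) = (\<Sum>v\<in>{1..n}. iexp (t * loglam n a d) * lnchar t (real (d v) / a))"
      by (intro sum.cong refl, subst loglam_upd) (auto simp: lnchar_def algebra_simps exp_add)
    then show "(1 / real n) *\<^sub>R (\<Sum>v\<in>{1..n}. iexp (t * loglam n a (d(v := Suc (d v))))) = iexp (t * loglam n a d) * ?A d"
      by (simp add: sum_distrib_left[symmetric])
  qed
  \<comment> \<open>Inserting \<open>stepfac\<close> separates the error of this throw from the
    error inherited from the earlier ones.\<close>
  also have "\<dots> = mexp n m (\<lambda>d. iexp (t * loglam n a d) * (?A d - stepfac n a t m) + stepfac n a t m * iexp (t * loglam n a d))"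
    by (simp add: algebra_simps)
  also have "\<dots> = mexp n m (\<lambda>d. iexp (t * loglam n a d) * (?A d - stepfac n a t m)) + stepfac n a t m * mexp n m (\<lambda>d. iexp (t * loglam n a d))"
    by (simp only: mexp_add mexp_mult)
  finally have eq: "mexp n (Suc m) (\<lambda>d. iexp (t * loglam n a d)) - (\<Prod>l<Suc m. stepfac n a t l) =
      mexp n m (\<lambda>d. iexp (t * loglam n a d) * (?A d - stepfac n a t m)) +
      stepfac n a t m * (mexp n m (\<lambda>d. iexp (t * loglam n a d)) - (\<Prod>l<m. stepfac n a t l))"
    by (simp add: algebra_simps)
  have "norm (mexp n (Suc m) (\<lambda>d. iexp (t * loglam n a d)) - (\<Prod>l<Suc m. stepfac n a t l))
     \<le> mexp n m (\<lambda>d. norm (iexp (t * loglam n a d) * (?A d - stepfac n a t m))) +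
     norm (stepfac n a t m) * norm (mexp n m (\<lambda>d. iexp (t * loglam n a d)) - (\<Prod>l<m. stepfac n a t l))"
    unfolding eq by (intro order_trans[OF norm_triangle_ineq] add_mono norm_mexp_le) (simp add: norm_mult)
  also have "\<dots> \<le> E + 1 * (real m * E)"
  proof (intro add_mono mult_mono st)
    show "mexp n m (\<lambda>d. norm (iexp (t * loglam n a d) * (?A d - stepfac n a t m))) \<le> E"
      unfolding norm_mult norm_exp_i_times mult_1_left
      by (rule avg) (rule Suc_le_lessD[OF Suc.prems])
    show "norm (mexp n m (\<lambda>d. iexp (t * loglam n a d)) - (\<Prod>l<m. stepfac n a t l)) \<le> real m * E"
      by (rule Suc.IH[OF Suc_leD[OF Suc.prems]])
  qed simp_all
  also have "\<dots> = real (Suc m) * E" by (simp add: algebra_simps)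
  finally show ?case .
qed

text \<open>With a = \<beta> sqrt n, third order Taylor terms are of order n^(-3/2), while the
  second order coefficient is of order 1/n and so multiplies the fluctuation of the empirical second
  moment. The constant does not depend on \<open>n\<close>, \<open>m\<close> or
  \<open>d\<close>.\<close>

lemma step_approx:
  fixes t \<beta> :: real
  assumes b: "\<beta> > 0"
  obtains C where "\<And>n m d. n > 0 \<Longrightarrow> m \<le> k * n \<Longrightarrow> sum d {1..n} = m \<Longrightarrow>
    norm ((1 / real n) *\<^sub>R (\<Sum>v\<in>{1..n}. lnchar t (real (d v) / (\<beta> * sqrt n))) - stepfac n (\<beta> * sqrt n) t m)
    \<le> C * ((avg_pow n 3 d + 1) / (sqrt n) ^ 3 + \<bar>collision_dev n m d\<bar> / n)"
proof -
  obtain K where K: "K \<ge> 0"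
    "\<And>x. x \<ge> 0 \<Longrightarrow> norm (lnchar t x - (1 + \<i> * t * x + lnchar2 t * x\<^sup>2)) \<le> K * x ^ 3"
    "\<And>x. x \<ge> 0 \<Longrightarrow> norm (lnchar t x - 1) \<le> K * x"
    using lnchar_Taylor[of t] by blast
  define c where "c = lnchar2 t"
  define B where "B = norm c * real k / \<beta>\<^sup>2"
  \<comment> \<open>One summand for each of the five errors: the Taylor remainders at d(v)/a and at
    \<open>y\<close>, the fluctuation \<open>collision_dev\<close>, the product of lnchar(y) - 1
    with c w, and the remainder of the exponential.\<close>
  define C where "C = K / \<beta>^3 + K * k^3 / \<beta>^3 + norm c / \<beta>\<^sup>2 + K * k * B / \<beta> + exp B * B\<^sup>2"
  have B0: "B \<ge> 0" by (simp add: B_def)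
  have C0: "K / \<beta>^3 \<le> C" "norm c / \<beta>\<^sup>2 \<le> C" "K * k^3 / \<beta>^3 + K * k * B / \<beta> + exp B * B\<^sup>2 \<le> C"
    using B0 K(1) b by (auto simp: C_def)
  show ?thesis
  proof (rule that[of C])
    fix n m :: nat and d :: "nat \<Rightarrow> nat"
    assume n: "n > 0" and mk: "m \<le> k * n" and d: "sum d {1..n} = m"
    define s where "s = sqrt n"
    define a where "a = \<beta> * s"
    define y where "y = real m / (real n * a)"
    define w where "w = (real m / real n - real m / (real n)\<^sup>2) / a\<^sup>2"
    have s: "s \<ge> 1" "s * s = n" using n by (auto simp: s_def)
    have a: "a > 0" using s b by (simp add: a_def)
    have mk': "real m / real n \<le> k" using mk n by (simp add: field_simps flip: of_nat_mult)
    have y: "y \<ge> 0" "y \<le> k / a" using mk' a by (auto simp: y_def divide_right_mono simp flip: divide_divide_eq_left)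
    have "real m / (real n)\<^sup>2 \<le> real m / real n"
      using n by (intro divide_left_mono) (auto simp: power2_eq_square)
    then have w0: "w \<ge> 0" by (simp add: w_def)
    have "real m / real n - real m / (real n)\<^sup>2 \<le> k" using mk'
      using divide_nonneg_nonneg[OF of_nat_0_le_iff[of m] zero_le_power2[of "real n"]] by linarith
    then have w: "w \<le> k / a\<^sup>2" by (simp add: w_def divide_right_mono)
    have cw: "norm (c * of_real w) \<le> B / s\<^sup>2"
    proof -
      have "norm (c * of_real w) = norm c * w" using w0 by (simp add: norm_mult)
      also have "\<dots> \<le> norm c * (k / a\<^sup>2)" using w by (intro mult_left_mono) auto
      finally show ?thesis by (simp add: B_def a_def power_mult_distrib)
    qed
    have "B / s\<^sup>2 \<le> B / 1" using B0 s one_le_power[of s 2] by (intro divide_left_mono) auto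
    then have cwB: "norm (c * of_real w) \<le> B" using cw by simp
    define A where "A = (1 / real n) *\<^sub>R (\<Sum>v\<in>{1..n}. lnchar t (real (d v) / a))"
    \<comment> \<open>The arguments average to exactly \<open>y\<close>, so the first order terms of
      \<open>A\<close> and of \<open>lnchar t y\<close> agree.\<close>
    have sum1: "(\<Sum>v\<in>{1..n}. complex_of_real (real (d v) / a)) = n * y"
    proof -
      have "(\<Sum>v\<in>{1..n}. real (d v) / a) = n * y"
        using d n by (simp add: y_def sum_divide_distrib[symmetric] flip: of_nat_sum)
      then show ?thesis by (metis of_real_sum of_real_mult of_real_of_nat_eq)
    qed
    have sum2: "(\<Sum>v\<in>{1..n}. (complex_of_real (real (d v) / a))\<^sup>2) = of_real (n * (avg_pow n 2 d / a\<^sup>2))"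
    proof -
      have "(\<Sum>v\<in>{1..n}. (real (d v) / a)\<^sup>2) = n * (avg_pow n 2 d / a\<^sup>2)"
        using n by (simp add: avg_pow_def power_divide sum_divide_distrib[symmetric])
      from arg_cong[OF this, of complex_of_real] show ?thesis
        by (simp only: of_real_sum of_real_mult of_real_power of_real_of_nat_eq)
    qed
    have sum3: "(\<Sum>v\<in>{1..n}. (real (d v) / a) ^ 3) = n * (avg_pow n 3 d / a ^ 3)"
      using n by (simp add: avg_pow_def power_divide sum_divide_distrib[symmetric])
    have "(\<Sum>v\<in>{1..n}. 1 + \<i> * t * complex_of_real (real (d v) / a) + c * (complex_of_real (real (d v) / a))\<^sup>2)
        = n * (1 + \<i> * t * y + c * of_real (avg_pow n 2 d / a\<^sup>2))"
      unfolding sum.distrib sum_distrib_left[symmetric] sum1 sum2 by (simp add: algebra_simps)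
    then have eq1: "A - (1 + \<i> * t * y + c * of_real (avg_pow n 2 d / a\<^sup>2)) = (1 / real n) *\<^sub>R (\<Sum>v\<in>{1..n}.
        lnchar t (real (d v) / a) - (1 + \<i> * t * complex_of_real (real (d v) / a) + c * (complex_of_real (real (d v) / a))\<^sup>2))"
      using n by (simp add: A_def sum_subtractf scaleR_conv_of_real diff_divide_distrib)
    have "norm (A - (1 + \<i> * t * y + c * of_real (avg_pow n 2 d / a\<^sup>2))) \<le> (1 / real n) * (\<Sum>v\<in>{1..n}. K * (real (d v) / a) ^ 3)"
      unfolding eq1 norm_scaleR
    proof (intro mult_mono order_trans[OF norm_sum] sum_mono)
      fix v
      show "norm (lnchar t (real (d v) / a) - (1 + \<i> * t * complex_of_real (real (d v) / a) + c * (complex_of_real (real (d v) / a))\<^sup>2)) \<le> K * (real (d v) / a) ^ 3"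
        unfolding c_def of_real_power[symmetric] by (rule K(2)) (use a in auto)
    qed (auto intro!: sum_nonneg)
    also have "\<dots> = K * (avg_pow n 3 d / a ^ 3)"
      unfolding sum_distrib_left[symmetric] sum3 using n by simp
    finally have e1: "norm (A - (1 + \<i> * t * y + c * of_real (avg_pow n 2 d / a\<^sup>2))) \<le> K * (avg_pow n 3 d / a ^ 3)" .
    have e2: "norm (lnchar t y - (1 + \<i> * t * y + c * y\<^sup>2)) \<le> K * (k / a) ^ 3"
      using K(2)[OF y(1)] y K(1) unfolding c_def
      by (meson mult_left_mono order_trans power_mono)
    \<comment> \<open>Empirical second moment as squared mean plus variance plus fluctuation: m(m -
      1)/n^2 is split into (m/n)^2 and -m/n^2, and the latter joins the variance.\<close>
    have wy: "avg_pow n 2 d / a\<^sup>2 = y\<^sup>2 + w + collision_dev n m d / a\<^sup>2"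
    proof -
      have "avg_pow n 2 d = (real m / n)\<^sup>2 + (real m / real n - real m / (real n)\<^sup>2) + collision_dev n m d"
        by (simp add: collision_dev_def power_divide power2_eq_square algebra_simps diff_divide_distrib)
      moreover have "y\<^sup>2 = (real m / n)\<^sup>2 / a\<^sup>2" by (simp add: y_def power_divide power_mult_distrib)
      ultimately show ?thesis by (simp add: w_def add_divide_distrib)
    qed
    have e3: "norm (c * of_real (collision_dev n m d / a\<^sup>2)) = norm c * \<bar>collision_dev n m d\<bar> / a\<^sup>2"
      by (simp add: norm_mult norm_divide power2_eq_square)
    have e4: "norm ((lnchar t y - 1) * (c * of_real w)) \<le> (K * (k / a)) * (B / s\<^sup>2)"
      unfolding norm_mult[of "lnchar t y - 1"]
      using K(1) a by (intro mult_mono cw order_trans[OF K(3)[OF y(1)] mult_left_mono[OF y(2) K(1)]]) auto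
    have "norm (exp (c * of_real w) - (\<Sum>i\<le>1. (c * of_real w) ^ i / fact i)) \<le>
        exp (norm (c * of_real w)) * norm (c * of_real w) ^ Suc 1 / fact 1"
      by (rule Taylor_exp_field)
    also have "\<dots> \<le> exp B * (B / s\<^sup>2) ^ 2"
      unfolding fact_1 div_by_1 Suc_1 using cw cwB by (intro mult_mono power_mono) auto
    finally have e5: "norm (lnchar t y * (exp (c * of_real w) - (1 + c * of_real w))) \<le> exp B * (B / s\<^sup>2) ^ 2"
      by (simp add: norm_mult)
    \<comment> \<open>Taylor errors, fluctuation of the empirical second moment, and the errors of replacing
      \<open>1 + c * w\<close> by an exponential and multiplying it into \<open>lnchar t y\<close>.\<close>
    have eq2: "A - lnchar t y * exp (c * of_real w) =
       (A - (1 + \<i> * t * y + c * of_real (avg_pow n 2 d / a\<^sup>2)))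
       - (lnchar t y - (1 + \<i> * t * y + c * y\<^sup>2))
       + c * of_real (collision_dev n m d / a\<^sup>2)
       - (lnchar t y - 1) * (c * of_real w)
       - lnchar t y * (exp (c * of_real w) - (1 + c * of_real w))"
      unfolding wy by (simp add: algebra_simps)
    have "norm (A - lnchar t y * exp (c * of_real w)) \<le> K * (avg_pow n 3 d / a ^ 3) + K * (k / a) ^ 3 + norm c * \<bar>collision_dev n m d\<bar> / a\<^sup>2
       + (K * (k / a)) * (B / s\<^sup>2) + exp B * (B / s\<^sup>2) ^ 2"
      unfolding eq2 by (intro order_trans[OF norm_triangle_ineq4] order_trans[OF norm_triangle_ineq] add_mono e1 e2 e4 e5 eq_refl[OF e3])
    also have "\<dots> = (K / \<beta>^3) * (avg_pow n 3 d / s^3) + (norm c / \<beta>\<^sup>2) * (\<bar>collision_dev n m d\<bar> / s\<^sup>2)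
       + (K * k^3 / \<beta>^3 + K * k * B / \<beta> + exp B * B\<^sup>2 / s) / s^3"
    proof -
      have "K * (k / a) * (B / s\<^sup>2) = (K * k * B / \<beta>) / s ^ 3"
        by (simp add: a_def power2_eq_square power3_eq_cube)
      moreover have "exp B * (B / s\<^sup>2) ^ 2 = (exp B * B\<^sup>2 / s) / s ^ 3"
        by (simp add: power_divide eval_nat_numeral)
      moreover have "K * (k / a) ^ 3 = (K * k^3 / \<beta>^3) / s ^ 3"
        by (simp add: a_def power_mult_distrib power_divide)
      moreover have "K * (avg_pow n 3 d / a ^ 3) = (K / \<beta>^3) * (avg_pow n 3 d / s^3)"
        by (simp add: a_def power_mult_distrib)
      moreover have "norm c * \<bar>collision_dev n m d\<bar> / a\<^sup>2 = (norm c / \<beta>\<^sup>2) * (\<bar>collision_dev n m d\<bar> / s\<^sup>2)"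
        by (simp add: a_def power_mult_distrib)
      ultimately show ?thesis by (simp only: add_divide_distrib add_ac)
    qed
    also have "\<dots> \<le> C * (avg_pow n 3 d / s^3) + C * (\<bar>collision_dev n m d\<bar> / s\<^sup>2) + C / s^3"
    proof (intro add_mono mult_right_mono divide_right_mono C0)
      \<comment> \<open>The remainder of the exponential is of order s^(-4); since s \<ge> 1 it fits
        into the s^(-3) term.\<close>
      have "exp B * B\<^sup>2 / s \<le> exp B * B\<^sup>2" using divide_left_mono[of 1 s "exp B * B\<^sup>2"] s by simp
      then show "K * k^3 / \<beta>^3 + K * k * B / \<beta> + exp B * B\<^sup>2 / s \<le> C" using C0(3) by linarith
    qed (use s in \<open>auto simp: avg_pow_def intro!: divide_nonneg_nonneg sum_nonneg\<close>)
    also have "\<dots> = C * ((avg_pow n 3 d + 1) / s ^ 3 + \<bar>collision_dev n m d\<bar> / n)"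
      using s by (simp add: power2_eq_square add_divide_distrib algebra_simps)
    finally show "norm ((1 / real n) *\<^sub>R (\<Sum>v\<in>{1..n}. lnchar t (real (d v) / (\<beta> * sqrt n))) - stepfac n (\<beta> * sqrt n) t m)
       \<le> C * ((avg_pow n 3 d + 1) / (sqrt n) ^ 3 + \<bar>collision_dev n m d\<bar> / n)"
      unfolding A_def a_def s_def stepfac_def y_def w_def c_def .
  qed
qed

section \<open>Limit of the characteristic function of the normalized log-likelihood ratio\<close>

definition loglik :: "nat \<Rightarrow> nat \<Rightarrow> real \<Rightarrow> (nat \<Rightarrow> nat) \<Rightarrow> real" where
  "loglik n m a d = loglam n a d - (\<Sum>l<m. ln (1 + real l / (real n * a)))"

text \<open>The phases \<open>lnchar t (m / (n * a))\<close> in the step factors multiply to exactly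
  the phase of the normalizing sum in \<open>loglik\<close>, so only the exponential factors
  survive. There are kn throws with error O(n^(-3/2)) each.\<close>

lemma mexp_loglik_char_approx:
  fixes t \<beta> :: real
  assumes b: "\<beta> > 0"
  obtains C where "\<And>n. n > 0 \<Longrightarrow>
    norm (mexp n (k * n) (\<lambda>d. iexp (t * loglik n (k * n) (\<beta> * sqrt n) d)) -
      exp (lnchar2 t * of_real (\<Sum>l<k*n. (real l / real n - real l / (real n)\<^sup>2) / (\<beta> * sqrt n)\<^sup>2))) \<le> C / sqrt n"
proof -
  obtain C where C: "\<And>n m d. n > 0 \<Longrightarrow> m \<le> k * n \<Longrightarrow> sum d {1..n} = m \<Longrightarrow>
    norm ((1 / real n) *\<^sub>R (\<Sum>v\<in>{1..n}. lnchar t (real (d v) / (\<beta> * sqrt n))) - stepfac n (\<beta> * sqrt n) t m)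
    \<le> C * ((avg_pow n 3 d + 1) / (sqrt n) ^ 3 + \<bar>collision_dev n m d\<bar> / n)"
    using step_approx[OF b, of k t] by blast
  \<comment> \<open>\<open>M\<close> bounds the mean of \<open>avg_pow n 3\<close>, and
    \<open>D / sqrt n\<close> that of the absolute fluctuation, uniformly over m < kn.\<close>
  define M where "M = real k * (3 * (real k)\<^sup>2 + 6 * real k + 1)"
  define D where "D = 4 * real k * (real k + (real k)\<^sup>2) + 1"
  show ?thesis
  proof (rule that[of "k * (\<bar>C\<bar> * (M + 1 + D))"])
    fix n :: nat assume n: "n > 0"
    define a where "a = \<beta> * sqrt n"
    define E where "E = \<bar>C\<bar> * ((M + 1) / (sqrt n) ^ 3 + D / sqrt n / n)"
    have a: "a > 0" using n b by (simp add: a_def)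
    have step: "mexp n m (\<lambda>d. norm ((1 / real n) *\<^sub>R (\<Sum>v\<in>{1..n}. lnchar t (real (d v) / a)) - stepfac n a t m)) \<le> E"
      if m: "m < k * n" for m
    proof -
      have mk: "real m / n \<le> k" using m n by (simp add: divide_le_eq flip: of_nat_mult)
      have "mexp n m (\<lambda>d. norm ((1 / real n) *\<^sub>R (\<Sum>v\<in>{1..n}. lnchar t (real (d v) / a)) - stepfac n a t m))
         \<le> mexp n m (\<lambda>d. \<bar>C\<bar> * ((1 / (sqrt n) ^ 3) * (avg_pow n 3 d + 1) + (1 / n) * \<bar>collision_dev n m d\<bar>))"
      proof (rule mexp_mono)
        fix d :: "nat \<Rightarrow> nat" assume d: "sum d {1..n} = m"
        have "norm ((1 / real n) *\<^sub>R (\<Sum>v\<in>{1..n}. lnchar t (real (d v) / a)) - stepfac n a t m)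
          \<le> C * ((avg_pow n 3 d + 1) / (sqrt n) ^ 3 + \<bar>collision_dev n m d\<bar> / n)"
          unfolding a_def using C[OF n _ d] m by simp
        \<comment> \<open>\<open>C\<close> comes without a sign; its absolute value keeps the later
          multiplication monotone.\<close>
        also have "\<dots> \<le> \<bar>C\<bar> * ((avg_pow n 3 d + 1) / (sqrt n) ^ 3 + \<bar>collision_dev n m d\<bar> / n)"
          by (intro mult_right_mono add_nonneg_nonneg divide_nonneg_nonneg) (auto simp: avg_pow_def intro!: sum_nonneg divide_nonneg_nonneg)
        finally show "norm ((1 / real n) *\<^sub>R (\<Sum>v\<in>{1..n}. lnchar t (real (d v) / a)) - stepfac n a t m)
          \<le> \<bar>C\<bar> * ((1 / (sqrt n) ^ 3) * (avg_pow n 3 d + 1) + (1 / n) * \<bar>collision_dev n m d\<bar>)"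
          by simp
      qed
      also have "\<dots> = \<bar>C\<bar> * ((1 / (sqrt n) ^ 3) * (mexp n m (avg_pow n 3) + 1) + (1 / n) * mexp n m (\<lambda>d. \<bar>collision_dev n m d\<bar>))"
        using n by (simp only: mexp_add mexp_mult mexp_const)
      also have "\<dots> \<le> \<bar>C\<bar> * ((1 / (sqrt n) ^ 3) * (M + 1) + (1 / n) * (D / sqrt n))"
      proof (intro mult_left_mono add_mono order_refl)
        have "mexp n m (avg_pow n 3) \<le> real m / real n * (3 * (real k)\<^sup>2 + 6 * real k + 1)"
          using n m by (intro mexp_avg_pow_3_le) auto
        also have "\<dots> \<le> M" unfolding M_def using mk by (intro mult_right_mono) auto
        finally show "mexp n m (avg_pow n 3) \<le> M" .
        show "mexp n m (\<lambda>d. \<bar>collision_dev n m d\<bar>) \<le> D / sqrt n"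
          unfolding D_def using n m by (intro mexp_abs_collision_dev_le) auto
      qed auto
      also have "\<dots> = E" by (simp add: E_def field_simps)
      finally show ?thesis .
    qed
    define c where "c = (\<Sum>l<k*n. ln (1 + real l / (real n * a)))"
    define w where "w = (\<Sum>l<k*n. (real l / real n - real l / (real n)\<^sup>2) / a\<^sup>2)"
    have prod: "(\<Prod>l<k*n. stepfac n a t l) = iexp (t * c) * exp (lnchar2 t * of_real w)"
      unfolding stepfac_def prod.distrib lnchar_def c_def w_def
      by (simp only: exp_sum[symmetric] finite_lessThan of_real_sum sum_distrib_left)
    have "mexp n (k*n) (\<lambda>d. iexp (t * loglik n (k*n) a d)) = mexp n (k*n) (\<lambda>d. iexp (- t * c) * iexp (t * loglam n a d))"
      by (simp add: loglik_def c_def algebra_simps flip: exp_add)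
    also have "\<dots> = iexp (- t * c) * mexp n (k*n) (\<lambda>d. iexp (t * loglam n a d))"
      by (rule mexp_mult)
    finally have 1: "mexp n (k*n) (\<lambda>d. iexp (t * loglik n (k*n) a d)) = iexp (- t * c) * mexp n (k*n) (\<lambda>d. iexp (t * loglam n a d))" .
    have 2: "exp (lnchar2 t * of_real w) = iexp (- t * c) * (\<Prod>l<k*n. stepfac n a t l)"
      unfolding prod by (simp add: mult_exp_exp)
    have "norm (mexp n (k*n) (\<lambda>d. iexp (t * loglik n (k*n) a d)) - exp (lnchar2 t * of_real w)) =
       norm (mexp n (k*n) (\<lambda>d. iexp (t * loglam n a d)) - (\<Prod>l<k*n. stepfac n a t l))"
      unfolding 1 2 right_diff_distrib[symmetric] norm_mult norm_exp_i_times by (rule mult_1_left)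
    also have "\<dots> \<le> real (k*n) * E"
      by (rule mexp_char_approx[OF n step order_refl])
    also have "\<dots> = k * (\<bar>C\<bar> * (M + 1 + D)) / sqrt n"
    proof -
      have "sqrt n ^ 3 = n * sqrt n" by (simp add: power3_eq_cube)
      then show ?thesis using n by (simp add: E_def field_simps)
    qed
    finally show "norm (mexp n (k * n) (\<lambda>d. iexp (t * loglik n (k * n) (\<beta> * sqrt n) d)) -
      exp (lnchar2 t * of_real (\<Sum>l<k*n. (real l / real n - real l / (real n)\<^sup>2) / (\<beta> * sqrt n)\<^sup>2)))
      \<le> k * (\<bar>C\<bar> * (M + 1 + D)) / sqrt n"
      unfolding a_def w_def .
  qed
qed

text \<open>The step variances sum to (kn(kn - 1)/2)(1/n - 1/n^2)/(\<beta>^2 n), which tends to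
  k^2/(2\<beta>^2).\<close>

lemma mexp_loglik_char_tendsto:
  fixes t \<beta> :: real
  assumes b: "\<beta> > 0"
  shows "(\<lambda>n. mexp n (k * n) (\<lambda>d. iexp (t * loglik n (k * n) (\<beta> * sqrt n) d))) \<longlonglongrightarrow>
    exp (lnchar2 t * of_real ((real k)\<^sup>2 / (2 * \<beta>\<^sup>2)))"
proof -
  define w where "w = (\<lambda>n. (\<Sum>l<k*n. (real l / real n - real l / (real n)\<^sup>2) / (\<beta> * sqrt n)\<^sup>2))"
  obtain C where C: "\<And>n. n > 0 \<Longrightarrow>
    norm (mexp n (k * n) (\<lambda>d. iexp (t * loglik n (k * n) (\<beta> * sqrt n) d)) - exp (lnchar2 t * of_real (w n))) \<le> C / sqrt n"
    using mexp_loglik_char_approx[OF b, of k t] unfolding w_def by blast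
  have "(\<lambda>n. C / sqrt (real n)) \<longlonglongrightarrow> 0"
    by (intro real_tendsto_divide_at_top[where c = C] tendsto_const
        filterlim_compose[OF sqrt_at_top filterlim_real_sequentially])
  then have 1: "(\<lambda>n. mexp n (k * n) (\<lambda>d. iexp (t * loglik n (k * n) (\<beta> * sqrt n) d)) - exp (lnchar2 t * of_real (w n))) \<longlonglongrightarrow> 0"
    by (rule Lim_null_comparison[rotated]) (use C in \<open>auto intro!: eventually_sequentiallyI[of 1]\<close>)
  have gauss: "(\<Sum>l<N. real l) = real N * (real N - 1) / 2" for N
    by (induction N) (auto simp: field_simps)
  have w: "w n = k * (1 - 1 / n) * (k - 1 / n) / (2 * \<beta>\<^sup>2)" if "n > 0" for n
  proof -
    have "w n = (\<Sum>l<k*n. real l) * ((1 / real n - 1 / (real n)\<^sup>2) / (\<beta> * sqrt n)\<^sup>2)"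
      unfolding w_def sum_distrib_right by (intro sum.cong refl) (simp add: right_diff_distrib)
    also have "\<dots> = (real k * real n) * (real k * real n - 1) / 2 * ((1 / real n - 1 / (real n)\<^sup>2) / (\<beta>\<^sup>2 * n))"
      unfolding gauss by (simp add: power_mult_distrib)
    also have "\<dots> = k * (1 - 1 / n) * (k - 1 / n) / (2 * \<beta>\<^sup>2)"
      using that b by (simp add: field_simps power2_eq_square)
    finally show ?thesis .
  qed
  have *: "(\<lambda>n. c - 1 / real n) \<longlonglongrightarrow> c - 0" for c
    by (rule tendsto_diff[OF tendsto_const lim_1_over_n])
  have "(\<lambda>n. real k * (1 - 1 / real n) * (real k - 1 / real n) / (2 * \<beta>\<^sup>2)) \<longlonglongrightarrow>
      real k * (1 - 0) * (real k - 0) / (2 * \<beta>\<^sup>2)"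
    using b by (intro tendsto_divide[OF tendsto_mult[OF tendsto_mult[OF tendsto_const *] *] tendsto_const]) simp
  moreover have "eventually (\<lambda>n. real k * (1 - 1 / real n) * (real k - 1 / real n) / (2 * \<beta>\<^sup>2) = w n) sequentially"
    by (rule eventually_sequentiallyI[of 1]) (simp add: w)
  ultimately have "w \<longlonglongrightarrow> real k * (1 - 0) * (real k - 0) / (2 * \<beta>\<^sup>2)"
    by (rule Lim_transform_eventually)
  then have "w \<longlonglongrightarrow> (real k)\<^sup>2 / (2 * \<beta>\<^sup>2)"
    by (simp add: power2_eq_square)
  then have 2: "(\<lambda>n. exp (lnchar2 t * of_real (w n))) \<longlonglongrightarrow> exp (lnchar2 t * of_real ((real k)\<^sup>2 / (2 * \<beta>\<^sup>2)))"
    by (intro tendsto_intros)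
  from tendsto_add[OF 1 2] show ?thesis by simp
qed

section \<open>Normalization of the likelihood ratio and the total variation distance\<close>

lemma mexp_exp_loglam:
  assumes "n > 0" "a > 0"
  shows "mexp n m (\<lambda>d. exp (loglam n a d)) = (\<Prod>l<m. 1 + real l / (real n * a))"
proof (induction m)
  case 0
  then show ?case by (simp add: loglam_def)
next
  case (Suc m)
  have "mexp n (Suc m) (\<lambda>d. exp (loglam n a d)) = mexp n m (\<lambda>d. (1 + real m / (real n * a)) * exp (loglam n a d))"
    unfolding mexp.simps
  proof (rule mexp_cong)
    fix d :: "nat \<Rightarrow> nat" assume d: "sum d {1..n} = m"
    have "(\<Sum>v\<in>{1..n}. exp (loglam n a (d(v := Suc (d v))))) = (\<Sum>v\<in>{1..n}. exp (loglam n a d) * (1 + real (d v) / a))"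
    proof (intro sum.cong refl)
      fix v assume v: "v \<in> {1..n}"
      have "1 + real (d v) / a > 0" using assms by (simp add: add_pos_nonneg)
      then show "exp (loglam n a (d(v := Suc (d v)))) = exp (loglam n a d) * (1 + real (d v) / a)"
        by (simp add: loglam_upd[OF v] exp_add)
    qed
    \<comment> \<open>The total is \<open>m\<close>, so the conditional mean of the new factor is
      deterministic and the recursion closes into a product.\<close>
    also have "\<dots> = exp (loglam n a d) * (n + m / a)"
      unfolding sum_distrib_left[symmetric] sum.distrib sum_divide_distrib[symmetric]
      using d by (simp flip: of_nat_sum)
    finally show "(1 / real n) *\<^sub>R (\<Sum>v\<in>{1..n}. exp (loglam n a (d(v := Suc (d v))))) =
      (1 + real m / (real n * a)) * exp (loglam n a d)"
      using assms by (simp add: field_simps)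
  qed
  then show ?case unfolding mexp_mult Suc by simp
qed

lemma exp_sum_ln_one_plus:
  assumes "a > 0"
  shows "exp (\<Sum>l<m. ln (1 + real l / a)) = (\<Prod>l<m. 1 + real l / a)"
  unfolding exp_sum[OF finite_lessThan] using assms by (intro prod.cong refl) (simp add: add_pos_nonneg)

text \<open>The sum subtracted in \<open>loglik\<close> is the logarithm of the mean of
  exp(\<open>loglam\<close>). This is why \<open>prob_alpha\<close> has total mass one.\<close>

lemma mexp_exp_loglik:
  assumes "n > 0" "a > 0"
  shows "mexp n m (\<lambda>d. exp (loglik n m a d)) = 1"
proof -
  define P where "P = exp (\<Sum>l<m. ln (1 + real l / (real n * a)))"
  have "mexp n m (\<lambda>d. exp (loglik n m a d)) = mexp n m (\<lambda>d. (1 / P) * exp (loglam n a d))"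
    by (simp add: loglik_def P_def exp_diff)
  also have "\<dots> = 1 / P * P"
    using assms exp_sum_ln_one_plus[of "real n * a" m] unfolding mexp_mult mexp_exp_loglam[OF assms] P_def by simp
  finally show ?thesis by (simp add: P_def)
qed

lemma pochhammer_eq_exp_sum_ln:
  assumes "(a::real) > 0"
  shows "pochhammer a m = a ^ m * exp (\<Sum>i<m. ln (1 + real i / a))"
proof -
  have "pochhammer a m = (\<Prod>i<m. a * (1 + real i / a))"
    unfolding pochhammer_prod using assms by (intro prod.cong) (auto simp: field_simps)
  then show ?thesis by (simp add: prod.distrib exp_sum_ln_one_plus[OF assms])
qed

lemma sum_indeg:
  assumes "M \<in> kout_maps n k"
  shows "(\<Sum>j\<in>{1..n}. indeg n k M j) = k * n"
proof -
  have "(\<Sum>j\<in>{1..n}. \<Sum>p\<in>{p\<in>{1..n} \<times> {1..k}. M p = j}. 1 :: nat) = (\<Sum>p\<in>{1..n} \<times> {1..k}. 1)"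
    using assms by (intro sum.group) (auto simp: kout_maps_def)
  then show ?thesis by (simp add: indeg_def)
qed

text \<open>Taking a factor \<open>a\<close> out of every factor of the rising factorials gives
  \<open>a ^ (k * n)\<close> above and below, since the in-degrees sum to kn; what is left below is
  \<open>n ^ (k * n)\<close> and the normalizing product.\<close>

lemma prob_alpha_eq:
  assumes "n > 0" "a > 0" "M \<in> kout_maps n k"
  shows "prob_alpha n k a M = exp (loglik n (k * n) a (indeg n k M)) / real n ^ (k * n)"
proof -
  have "(\<Prod>j\<in>{1..n}. pochhammer a (indeg n k M j)) = a ^ (k * n) * exp (loglam n a (indeg n k M))"
    unfolding pochhammer_eq_exp_sum_ln[OF assms(2)] prod.distrib loglam_def
    by (simp add: exp_sum flip: sum_indeg[OF assms(3)] power_sum)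
  moreover have "pochhammer (a * n) (k * n) = a ^ (k * n) * real n ^ (k * n) * exp (\<Sum>i<k*n. ln (1 + real i / (real n * a)))"
    using assms pochhammer_eq_exp_sum_ln[of "a * n" "k * n"] by (simp add: power_mult_distrib mult.commute)
  ultimately show ?thesis
    using assms by (simp add: prob_alpha_def loglik_def exp_diff field_simps)
qed

lemma finite_kout_maps: "finite (kout_maps n k)"
  by (simp add: kout_maps_def finite_PiE)

lemma kout_maps_nonempty: "kout_maps n k \<noteq> {}"
  by (auto simp: kout_maps_def PiE_eq_empty_iff)

lemma sum_kout_maps_eq_mexp:
  assumes "n > 0"
  shows "(\<Sum>M\<in>kout_maps n k. G (indeg n k M)) = (real n ^ (k * n)) *\<^sub>R mexp n (k * n) G"
  using mexp_eq_average[of "{1..n} \<times> {1..k}" n G] assms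
  by (simp add: kout_maps_def indeg_def[abs_def] mult.commute)

text \<open>The supremum is attained where \<open>p\<close> is below \<open>q\<close>. Equal total
  masses make the difference change sign under complement, which takes care of the absolute
  value.\<close>

lemma SUP_abs_sum_diff_eq:
  fixes p q :: "'a \<Rightarrow> real"
  assumes "finite S" "sum p S = sum q S"
  shows "(SUP A\<in>Pow S. \<bar>sum p A - sum q A\<bar>) = (\<Sum>x\<in>S. max 0 (q x - p x))"
proof (rule cSup_eq_maximum)
  define P where "P = {x\<in>S. p x < q x}"
  have "sum q P - sum p P = (\<Sum>x\<in>P. max 0 (q x - p x))"
    unfolding sum_subtractf[symmetric] by (intro sum.cong) (auto simp: P_def)
  also have "\<dots> = (\<Sum>x\<in>S. max 0 (q x - p x))"
    using assms by (intro sum.mono_neutral_left) (auto simp: P_def)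
  finally have *: "sum q P - sum p P = (\<Sum>x\<in>S. max 0 (q x - p x))" .
  have "0 \<le> (\<Sum>x\<in>S. max 0 (q x - p x))" by (intro sum_nonneg) auto
  with * show "(\<Sum>x\<in>S. max 0 (q x - p x)) \<in> (\<lambda>A. \<bar>sum p A - sum q A\<bar>) ` Pow S"
    by (intro image_eqI[of _ _ P]) (auto simp: P_def)
next
  fix y assume "y \<in> (\<lambda>A. \<bar>sum p A - sum q A\<bar>) ` Pow S"
  then obtain A where A: "A \<subseteq> S" "y = \<bar>sum p A - sum q A\<bar>" by auto
  have le: "sum q B - sum p B \<le> (\<Sum>x\<in>S. max 0 (q x - p x))" if "B \<subseteq> S" for B
  proof -
    have "sum q B - sum p B \<le> (\<Sum>x\<in>B. max 0 (q x - p x))"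
      unfolding sum_subtractf[symmetric] by (intro sum_mono) auto
    also have "\<dots> \<le> (\<Sum>x\<in>S. max 0 (q x - p x))"
      using assms that by (intro sum_mono2) auto
    finally show ?thesis .
  qed
  have "sum p (S - A) = sum p S - sum p A" "sum q (S - A) = sum q S - sum q A"
    using assms A by (simp_all add: sum_diff finite_subset)
  with le[OF A(1)] le[of "S - A"] A(2) assms(2) show "y \<le> (\<Sum>x\<in>S. max 0 (q x - p x))"
    by auto
qed

text \<open>The positive part of 1 - L is used instead of |1 - L| / 2 because it is bounded, so that
  weak convergence applies to it.\<close>

lemma dTV_alpha_unif_eq:
  assumes "n > 0" "a > 0"
  shows "dTV_alpha_unif n k a = mexp n (k * n) (\<lambda>d. max 0 (1 - exp (loglik n (k * n) a d)))"
proof -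
  define c where "c = real n ^ (k * n)"
  have c: "c > 0" using assms by (simp add: c_def)
  define l where "l = loglik n (k * n) a"
  have p: "prob_alpha n k a M = exp (l (indeg n k M)) / c" if "M \<in> kout_maps n k" for M
    unfolding l_def c_def using that assms by (rule prob_alpha_eq[rotated 2])
  have "(\<Sum>M\<in>kout_maps n k. prob_alpha n k a M) = (\<Sum>M\<in>kout_maps n k. exp (l (indeg n k M))) / c"
    by (simp add: p sum_divide_distrib)
  also have "\<dots> = 1"
    unfolding sum_kout_maps_eq_mexp[OF assms(1), of "\<lambda>d. exp (l d)"]
    using assms c by (simp add: l_def mexp_exp_loglik c_def)
  also have "1 = (\<Sum>M\<in>kout_maps n k. prob_unif n k M)"
    using sum_kout_maps_eq_mexp[OF assms(1), of "\<lambda>d. 1 :: real" k] c assms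
    by (simp add: prob_unif_def c_def mexp_const)
  finally have "dTV_alpha_unif n k a = (\<Sum>M\<in>kout_maps n k. max 0 (prob_unif n k M - prob_alpha n k a M))"
    unfolding dTV_alpha_unif_def by (intro SUP_abs_sum_diff_eq finite_kout_maps)
  also have "\<dots> = (\<Sum>M\<in>kout_maps n k. max 0 (1 - exp (l (indeg n k M)))) / c"
    unfolding sum_divide_distrib
  proof (intro sum.cong refl)
    fix M assume "M \<in> kout_maps n k"
    then have "prob_unif n k M - prob_alpha n k a M = (1 - exp (l (indeg n k M))) / c"
      by (simp add: p prob_unif_def c_def diff_divide_distrib)
    then show "max 0 (prob_unif n k M - prob_alpha n k a M) = max 0 (1 - exp (l (indeg n k M))) / c"
      using c by (simp add: max_def divide_le_0_iff zero_le_divide_iff)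
  qed
  also have "\<dots> = mexp n (k * n) (\<lambda>d. max 0 (1 - exp (l d)))"
    unfolding sum_kout_maps_eq_mexp[OF assms(1), of "\<lambda>d. max 0 (1 - exp (l d))"] using c by (simp add: c_def)
  finally show ?thesis unfolding l_def .
qed

subsection \<open>Gaussian limit\<close>

text \<open>Reduces the characteristic function of a general Gaussian to the standard one.\<close>

lemma distr_std_normal_affine:
  assumes "\<sigma> > 0"
  shows "density lborel (normal_density \<mu> \<sigma>) = distr std_normal_distribution lborel (\<lambda>x. \<mu> + \<sigma> * x)"
proof -
  interpret prob_space std_normal_distribution by (rule prob_space_normal_density) simp
  have "distributed std_normal_distribution lborel (\<lambda>x. x) std_normal_density"
    by (auto simp: distributed_def distr_id2)
  from normal_density_affine[OF this, of \<sigma> \<mu>] assms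
  have "distributed std_normal_distribution lborel (\<lambda>x. \<mu> + \<sigma> * x) (normal_density \<mu> \<sigma>)"
    by simp
  then show ?thesis by (simp add: distributed_def)
qed

lemma char_normal_density:
  assumes "\<sigma> > 0"
  shows "char (density lborel (normal_density \<mu> \<sigma>)) t = exp (\<i> * of_real (t * \<mu>) - of_real ((t * \<sigma>)\<^sup>2 / 2))"
proof -
  have "char (density lborel (normal_density \<mu> \<sigma>)) t = (CLINT x|std_normal_distribution. iexp (t * (\<mu> + \<sigma> * x)))"
    unfolding distr_std_normal_affine[OF assms] char_def by (subst integral_distr) auto
  also have "\<dots> = (CLINT x|std_normal_distribution. iexp (t * \<mu>) * iexp ((t * \<sigma>) * x))"
    by (simp add: algebra_simps exp_add)
  also have "\<dots> = iexp (t * \<mu>) * char std_normal_distribution (t * \<sigma>)"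
    unfolding char_def by (rule integral_mult_right_zero)
  also have "\<dots> = iexp (t * \<mu>) * exp (of_real (- (t * \<sigma>)\<^sup>2 / 2))"
    unfolding char_std_normal_distribution by (simp only: exp_of_real)
  also have "\<dots> = exp (\<i> * of_real (t * \<mu>) - of_real ((t * \<sigma>)\<^sup>2 / 2))"
    unfolding mult_exp_exp by (rule arg_cong[of _ _ exp]) simp
  finally show ?thesis .
qed

text \<open>Completing the square: the tilt shifts the mean down by the variance. With the mean at
  half the variance no constant factor remains.\<close>

lemma normal_density_exp_tilt:
  assumes "\<sigma> > 0"
  shows "normal_density (\<sigma>\<^sup>2 / 2) \<sigma> x * exp (- x) = normal_density (- (\<sigma>\<^sup>2 / 2)) \<sigma> x"
proof -
  have "- (x - \<sigma>\<^sup>2 / 2)\<^sup>2 / (2 * \<sigma>\<^sup>2) + - x = - (x - - (\<sigma>\<^sup>2 / 2))\<^sup>2 / (2 * \<sigma>\<^sup>2)"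
    using assms by (simp add: field_simps power2_eq_square)
  then show ?thesis
    unfolding normal_density_def by (simp only: mult.assoc exp_add[symmetric])
qed

text \<open>By the tilt, exp(-x) integrates to 1, so 1 - exp(-x) has mean zero and its positive part
  carries half of the mean absolute value.\<close>

lemma integral_normal_positive_part:
  assumes "\<sigma> > 0"
  defines "N \<equiv> density lborel (normal_density (\<sigma>\<^sup>2 / 2) \<sigma>)"
  shows "(LINT x|N. max 0 (1 - exp (- x))) = (1/2) * (LINT x|N. \<bar>1 - exp (- x)\<bar>)"
proof -
  interpret N: prob_space N unfolding N_def using assms by (intro prob_space_normal_density)
  have i: "integrable N (\<lambda>x. exp (- x))"
    unfolding N_def using assms by (subst integrable_density) (auto simp: normal_density_exp_tilt)
  have "(LINT x|N. exp (- x)) = 1"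
    unfolding N_def using assms by (subst integral_density) (auto simp: normal_density_exp_tilt)
  with i have 0: "(LINT x|N. 1 - exp (- x)) = 0" by (simp add: N.prob_space)
  have "(LINT x|N. max 0 (1 - exp (- x))) = (LINT x|N. (1/2) * (\<bar>1 - exp (- x)\<bar> + (1 - exp (- x))))"
    by (intro Bochner_Integration.integral_cong) (auto simp: max_def abs_if)
  also have "\<dots> = (1/2) * ((LINT x|N. \<bar>1 - exp (- x)\<bar>) + (LINT x|N. 1 - exp (- x)))"
    using i by (subst integral_mult_right_zero, subst Bochner_Integration.integral_add) auto
  finally show ?thesis using 0 by simp
qed

theorem theorem1:
  fixes k :: nat and \<beta> :: real
  assumes "k \<ge> 1" and "\<beta> > 0"
  shows "(\<lambda>n. dTV_alpha_unif n k (\<beta> * sqrt (real n)))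
           \<longlonglongrightarrow>
         (1/2) * integral\<^sup>L
            (density lborel (normal_density (real k ^ 2 / (4 * \<beta>^2)) (sqrt (real k ^ 2 / (2 * \<beta>^2)))))
            (\<lambda>x. \<bar>1 - exp (- x)\<bar>)"
proof -
  define \<sigma> where "\<sigma> = sqrt (real k ^ 2 / (2 * \<beta>^2))"
  have \<sigma>: "\<sigma> > 0" using assms by (simp add: \<sigma>_def)
  have \<sigma>2: "\<sigma>\<^sup>2 = (real k)\<^sup>2 / (2 * \<beta>\<^sup>2)" by (simp add: \<sigma>_def)
  define N where "N = density lborel (normal_density (\<sigma>\<^sup>2 / 2) \<sigma>)"
  \<comment> \<open>The sign is reversed so that the likelihood ratio is exp(-X), matching exp(-x)
    in the limit.\<close>
  define X where "X = (\<lambda>n M. - loglik n (k * n) (\<beta> * sqrt n) (indeg n k M))"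
  define R where "R = (\<lambda>n. distr (measure_pmf (pmf_of_set (kout_maps n k))) borel (X n))"
  interpret N: prob_space N unfolding N_def using \<sigma> by (intro prob_space_normal_density)
  have N: "real_distribution N" by unfold_locales (auto simp: N_def)
  have R: "real_distribution (R n)" for n
    unfolding R_def by (intro prob_space.real_distribution_distr measure_pmf.prob_space_axioms) auto
  have int: "(LINT x|R n. f x) = mexp n (k * n) (\<lambda>d. f (- loglik n (k * n) (\<beta> * sqrt n) d))"
    if n: "n > 0" and f: "f \<in> borel_measurable borel" for n and f :: "real \<Rightarrow> 'b::{banach, second_countable_topology}"
  proof -
    have "card (kout_maps n k) = n ^ (k * n)"
      by (simp add: kout_maps_def card_PiE mult.commute)
    moreover have "(LINT x|R n. f x) = (LINT M|pmf_of_set (kout_maps n k). f (X n M))"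
      unfolding R_def using f by (intro integral_distr) auto
    moreover have "\<dots> = (\<Sum>M\<in>kout_maps n k. pmf (pmf_of_set (kout_maps n k)) M *\<^sub>R f (X n M))"
      by (intro integral_measure_pmf finite_kout_maps)
        (use set_pmf_of_set[OF kout_maps_nonempty finite_kout_maps] in auto)
    ultimately have "(LINT x|R n. f x) = (1 / real n ^ (k * n)) *\<^sub>R (\<Sum>M\<in>kout_maps n k. f (X n M))"
      by (simp add: pmf_of_set kout_maps_nonempty finite_kout_maps scaleR_sum_right)
    then show ?thesis
      unfolding X_def sum_kout_maps_eq_mexp[OF n, of "\<lambda>d. f (- loglik n (k * n) (\<beta> * sqrt n) d)"]
      using n by simp
  qed
  have "(\<lambda>n. char (R n) t) \<longlonglongrightarrow> char N t" for t
  proof -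
    \<comment> \<open>Because of the reversed sign the limit is taken at -t:
      \<open>lnchar2 (- t)\<close> is (it - t^2)/2, so the mean comes out as half the
      variance.\<close>
    have "(\<lambda>n. mexp n (k * n) (\<lambda>d. iexp (- t * loglik n (k * n) (\<beta> * sqrt n) d))) \<longlonglongrightarrow> exp (lnchar2 (- t) * of_real (\<sigma>\<^sup>2))"
      unfolding \<sigma>2 using assms by (intro mexp_loglik_char_tendsto)
    also have "exp (lnchar2 (- t) * of_real (\<sigma>\<^sup>2)) = char N t"
      unfolding N_def char_normal_density[OF \<sigma>]
      by (rule arg_cong[of _ _ exp]) (simp add: lnchar2_def field_simps power2_eq_square)
    finally show ?thesis
      by (rule Lim_transform_eventually)
        (auto intro!: eventually_sequentiallyI[of 1] simp: char_def int)
  qed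
  then have weak: "weak_conv_m R N"
    by (rule levy_continuity[OF R N])
  \<comment> \<open>Continuous with values in [0,1], hence an admissible test function for weak
    convergence.\<close>
  define g :: "real \<Rightarrow> real" where "g = (\<lambda>x. max 0 (1 - exp (- x)))"
  have "(\<lambda>n. LINT x|R n. g x) \<longlonglongrightarrow> (LINT x|N. g x)"
    by (rule weak_conv_imp_integral_bdd_continuous_conv[OF R N weak, where B = 1])
       (auto simp: g_def intro!: continuous_intros)
  moreover have "eventually (\<lambda>n. (LINT x|R n. g x) = dTV_alpha_unif n k (\<beta> * sqrt n)) sequentially"
  proof (rule eventually_sequentiallyI[of 1])
    fix n :: nat assume "n \<ge> 1"
    moreover have "g \<in> borel_measurable borel" unfolding g_def by measurable
    ultimately show "(LINT x|R n. g x) = dTV_alpha_unif n k (\<beta> * sqrt n)"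
      using assms by (subst int) (auto simp: dTV_alpha_unif_eq g_def)
  qed
  ultimately have "(\<lambda>n. dTV_alpha_unif n k (\<beta> * sqrt n)) \<longlonglongrightarrow> (LINT x|N. g x)"
    by (rule Lim_transform_eventually)
  also have "(LINT x|N. g x) = (1/2) * (LINT x|N. \<bar>1 - exp (- x)\<bar>)"
    unfolding g_def N_def by (rule integral_normal_positive_part[OF \<sigma>])
  also have "N = density lborel (normal_density (real k ^ 2 / (4 * \<beta>^2)) (sqrt (real k ^ 2 / (2 * \<beta>^2))))"
    unfolding N_def \<sigma>2 \<sigma>_def by simp
  finally show ?thesis .
qed

end
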